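(* Let $X_1,\dots,X_n$ be an i.i.d. sample of trajectories from the London model with start $c$ and step $\delta$, and for each $t\in\{0,1,\dots,m\}$ and $0\le k\le m$ let $$c_t(k):=\#\{i:X_i(t)=c+\delta k\}.$$ Then there exists a function $h$ such that the likelihood satisfies $\mathrm{lik}(\{X_i(t)\}_{i,t}\mid p,q,t^* )=h(\{c_t(k)\}_{t,k}\mid p,q,t^* )$, so that the marginal counts $c_t(k)$ are sufficient statistics for the London model. Moreover, for each $t\in\{1,\dots,m\}$, the maximum likelihood estimates of $p$ and $q$ (maximizing over $(p,q)\in[0,1]^2$), assuming that the changepoint occurs at time $t$, are given by $$\hat p(t)=\frac{1}{t-1}\sum_{j=0}^{t-1}j\,\frac{c_{t-1}(j)}{n}\ \ (t\ge2),\qquad \hat q(t)=\frac{1}{m-t+1}\sum_{k=0}^mk\,\frac{c_m(k)-c_{t-1}(k)}{n}.$$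
   Context: London model with time indices $0,1,\dots,m$: let $c\ge0$, $\delta>0$ be known constants with $c+\delta m\le1$. A trajectory $X$ starts at $X(0)=c$ and for $s=1,\dots,m$, independently over $s$, $X(s)=X(s-1)+\delta$ with probability $p_s$ and $X(s)=X(s-1)$ with probability $1-p_s$, where $p_s=p$ for $s<t^*$ and $p_s=q$ for $s\ge t^*$; here $t^*\in\{1,\dots,m\}$ is the integer changepoint index. The likelihood $\mathrm{lik}(\cdot\mid p,q,t^* )$ is the joint probability of the $n$ observed trajectories (each of which starts at $c$ and has increments in $\{0,\delta\}$) under parameters $p,q,t^*$. *)

theory Defs
  imports "HOL-Probability.Probability"
begin

primrec london_path :: "real \<Rightarrow> real \<Rightarrow> (nat \<Rightarrow> bool) \<Rightarrow> nat \<Rightarrow> real" where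
  "london_path c \<delta> \<omega> 0 = c"
| "london_path c \<delta> \<omega> (Suc s) = london_path c \<delta> \<omega> s + (if \<omega> (Suc s) then \<delta> else 0)"

definition step_prob :: "real \<Rightarrow> real \<Rightarrow> nat \<Rightarrow> nat \<Rightarrow> real" where
  "step_prob p q ts s = (if s < ts then p else q)"

text \<open>
  Trajectories have time indices \<open>0, \<dots>, m\<close> but are represented by functions on all of \<^typ>\<open>nat\<close>.
  Since there are no jumps after time \<open>m\<close>, a random trajectory stays at its value at \<open>m\<close> from
  then on. Everything below looks at times up to \<open>m\<close> only.
  The success parameter of \<^const>\<open>bernoulli_pmf\<close> is truncated to the unit interval, so the
  parameters are meaningful for \<open>0 \<le> p, q \<le> 1\<close> only.
\<close>

definition london_pmf ::
  "real \<Rightarrow> real \<Rightarrow> nat \<Rightarrow> real \<Rightarrow> real \<Rightarrow> nat \<Rightarrow> (nat \<Rightarrow> real) pmf" where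
  "london_pmf c \<delta> m p q ts =
     map_pmf (london_path c \<delta>)
       (Pi_pmf {1..m} False (\<lambda>s. bernoulli_pmf (step_prob p q ts s)))"

definition london_sample_pmf ::
  "real \<Rightarrow> real \<Rightarrow> nat \<Rightarrow> nat \<Rightarrow> real \<Rightarrow> real \<Rightarrow> nat \<Rightarrow> (nat \<Rightarrow> nat \<Rightarrow> real) pmf" where
  "london_sample_pmf c \<delta> m n p q ts =
     Pi_pmf {1..n} undefined (\<lambda>_. london_pmf c \<delta> m p q ts)"

definition lik ::
  "real \<Rightarrow> real \<Rightarrow> nat \<Rightarrow> nat \<Rightarrow> (nat \<Rightarrow> nat \<Rightarrow> real) \<Rightarrow> real \<Rightarrow> real \<Rightarrow> nat \<Rightarrow> real" where
  "lik c \<delta> m n X p q ts =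
     measure_pmf.prob (london_sample_pmf c \<delta> m n p q ts)
       {Y. \<forall>i\<in>{1..n}. \<forall>s\<in>{0..m}. Y i s = X i s}"

definition london_data :: "real \<Rightarrow> real \<Rightarrow> nat \<Rightarrow> nat \<Rightarrow> (nat \<Rightarrow> nat \<Rightarrow> real) \<Rightarrow> bool" where
  "london_data c \<delta> m n X \<longleftrightarrow>
     (\<forall>i\<in>{1..n}. X i 0 = c \<and> (\<forall>s\<in>{1..m}. X i s - X i (s - 1) \<in> {0, \<delta>}))"

definition marginal_count ::
  "real \<Rightarrow> real \<Rightarrow> nat \<Rightarrow> (nat \<Rightarrow> nat \<Rightarrow> real) \<Rightarrow> nat \<Rightarrow> nat \<Rightarrow> nat" where
  "marginal_count c \<delta> n X t k = card {i \<in> {1..n}. X i t = c + \<delta> * real k}"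

text \<open>
  The restriction makes sure that a function of the counts has access to those with
  \<open>t \<le> m\<close> and \<open>k \<le> m\<close> only.
\<close>

definition marginal_counts ::
  "real \<Rightarrow> real \<Rightarrow> nat \<Rightarrow> nat \<Rightarrow> (nat \<Rightarrow> nat \<Rightarrow> real) \<Rightarrow> nat \<times> nat \<Rightarrow> nat" where
  "marginal_counts c \<delta> m n X =
     restrict (\<lambda>(t, k). marginal_count c \<delta> n X t k) ({0..m} \<times> {0..m})"

text \<open>
  Sufficiency for a family of discrete distributions: the conditional distribution of the
  sample given the value of the statistic does not depend on the parameter. Conditioning is
  on values that the statistic attains with positive probability.
\<close>

definition sufficient_statistic ::
  "('p \<Rightarrow> 'x pmf) \<Rightarrow> 'p set \<Rightarrow> ('x \<Rightarrow> 'y) \<Rightarrow> bool" where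
  "sufficient_statistic P \<Theta> T \<longleftrightarrow>
     (\<exists>K. \<forall>\<theta>\<in>\<Theta>. \<forall>\<tau>\<in>T ` set_pmf (P \<theta>). cond_pmf (P \<theta>) {x. T x = \<tau>} = K \<tau>)"

text \<open>
  For \<open>t = 1\<close> this is a division by zero; no step is then governed by \<open>p\<close>, and the estimate is
  meant for \<open>t \<ge> 2\<close> only.
\<close>

definition p_hat :: "real \<Rightarrow> real \<Rightarrow> nat \<Rightarrow> (nat \<Rightarrow> nat \<Rightarrow> real) \<Rightarrow> nat \<Rightarrow> real" where
  "p_hat c \<delta> n X t =
     1 / (real t - 1) *
     (\<Sum>j = 0..t - 1. real j * (real (marginal_count c \<delta> n X (t - 1) j) / real n))"

definition q_hat :: "real \<Rightarrow> real \<Rightarrow> nat \<Rightarrow> nat \<Rightarrow> (nat \<Rightarrow> nat \<Rightarrow> real) \<Rightarrow> nat \<Rightarrow> real" where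
  "q_hat c \<delta> m n X t =
     1 / (real m - real t + 1) *
     (\<Sum>k = 0..m. real k *
        ((real (marginal_count c \<delta> n X m k) - real (marginal_count c \<delta> n X (t - 1) k)) / real n))"

text \<open>Maximizers over \<open>(p, q)\<close> of the likelihood with the changepoint index \<open>t\<close> held fixed.\<close>

definition MLE_set ::
  "real \<Rightarrow> real \<Rightarrow> nat \<Rightarrow> nat \<Rightarrow> (nat \<Rightarrow> nat \<Rightarrow> real) \<Rightarrow> nat \<Rightarrow> (real \<times> real) set" where
  "MLE_set c \<delta> m n X t =
     {pq. is_arg_max (\<lambda>(p, q). lik c \<delta> m n X p q t) (\<lambda>x. x \<in> {0..1} \<times> {0..1}) pq}"

end

theory Submission imports Defs begin

text \<open>
  A trajectory is determined by its jumps, and the jumps are independent, so the likelihood is a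
  product over time steps: if \<open>N s\<close> of the \<open>n\<close> trajectories jump at step \<open>s\<close>, then step \<open>s\<close>
  contributes \<open>\<theta> ^ N s * (1 - \<theta>) ^ (n - N s)\<close>, where \<open>\<theta>\<close> is the jump probability in force at \<open>s\<close>
  (\<open>lik_eq_prod_step_count\<close>).

  The marginal counts determine every \<open>N s\<close>. Summing the level \<open>k\<close> over all trajectories at time
  \<open>t\<close>, that is, forming \<open>\<Sum>k. k * c\<^sub>t(k)\<close>, counts all jumps of the sample up to time \<open>t\<close>
  (\<open>level_sum_eq_jumps\<close>), and \<open>N s\<close> is the difference of two consecutive such sums. This gives the
  function \<open>h\<close>.

  Sufficiency follows because all samples of trajectories of the model with the same counts have
  the same probability. Conditioning on the counts thus yields the uniform distribution on
  finitely many samples, whatever the parameters are (\<open>sufficient_statisticI\<close>). This covers the boundary values of the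
  parameters as well: if some sample with the given counts has positive probability then all
  of them do.

  For the estimates, fix the changepoint \<open>t\<close>. Collecting the steps before \<open>t\<close> and those from \<open>t\<close>
  on turns the likelihood into a product of two Bernoulli likelihoods \<open>x ^ a * (1 - x) ^ b\<close>, one
  in \<open>p\<close> and one in \<open>q\<close> (\<open>lik_eq_two_bernoulli\<close>). Their maximizers can be computed separately
  (\<open>is_arg_max_mult_iff\<close>), and each has the unique maximizer \<open>a / (a + b)\<close> unless it has no factors
  at all (\<open>is_arg_max_bernoulli_iff\<close>). The latter happens for \<open>p\<close> when \<open>t = 1\<close>, and then every \<open>p\<close>
  maximizes.
\<close>

section \<open>Maximizing Bernoulli likelihoods\<close>

text \<open>
  The inequality \<open>z < exp (z - 1)\<close> for \<open>z \<noteq> 1\<close> is applied to \<open>x / x0\<close> and to \<open>(1 - x) / (1 - x0)\<close>,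
  where \<open>x0 = a / (a + b)\<close>. The exponents then cancel:
  \<open>a * (x / x0 - 1) + b * ((1 - x) / (1 - x0) - 1) = (a + b) * x - a + (a + b) * (1 - x) - b = 0\<close>.
  If \<open>a\<close> or \<open>b\<close> is zero, one of the quotients is undefined and the claim is monotonicity of a power.
\<close>

lemma bernoulli_likelihood_less:
  fixes x :: real and a b :: nat
  assumes x: "0 \<le> x" "x \<le> 1" and ab: "a + b > 0" and ne: "x \<noteq> a / (a + b)"
  shows "x ^ a * (1 - x) ^ b < (a / (a + b)) ^ a * (1 - a / (a + b)) ^ b"
proof -
  consider "a = 0" | "b = 0" | "a > 0" "b > 0" by blast
  then show ?thesis
  proof cases
    case 1
    then have "0 < b" "0 < x" using ab ne x by auto
    then have "(1 - x) ^ b < 1" using x by (simp add: power_less_one_iff)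
    then show ?thesis using 1 by simp
  next
    case 2
    then have "0 < a" "x < 1" using ab ne x by auto
    then have "x ^ a < 1" using x by (simp add: power_less_one_iff)
    then show ?thesis using 2 \<open>0 < a\<close> by simp
  next
    case 3
    define N where "N = real (a + b)"
    define x0 where "x0 = a / N"
    have N: "N > 0" using ab unfolding N_def by (simp only: of_nat_0_less_iff)
    have x0: "0 < x0" "x0 < 1" using 3 by (auto simp: x0_def N_def)
    have x0': "1 - x0 = b / N" using 3 by (simp add: x0_def N_def field_simps)
    define z where "z = x / x0"
    define w where "w = (1 - x) / (1 - x0)"
    have zw: "0 \<le> z" "0 \<le> w" using x x0 by (auto simp: z_def w_def)
    have "x \<noteq> x0" using ne unfolding x0_def N_def .
    then have "z \<noteq> 1" using x0 by (simp add: z_def)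
    have z_less: "z < exp (z - 1)"
    proof (cases "z = 0")
      case False
      then have "ln z < z - 1"
        using zw(1) \<open>z \<noteq> 1\<close> ln_eq_minus_one[of z] ln_le_minus_one[of z] by fastforce
      then show ?thesis using False zw(1) by (metis exp_less_cancel_iff exp_ln less_eq_real_def)
    qed simp
    have w_le: "w \<le> exp (w - 1)" using exp_ge_add_one_self[of "w - 1"] by simp
    have "a * (z - 1) = N * x - a" "b * (w - 1) = N * (1 - x) - b"
      unfolding z_def w_def x0' using 3 N by (simp_all add: x0_def field_simps)
    then have cancel: "a * (z - 1) + b * (w - 1) = 0"
      by (simp add: N_def algebra_simps)
    have "z ^ a * w ^ b \<le> z ^ a * exp (w - 1) ^ b"
      using zw w_le by (intro mult_left_mono power_mono) auto
    also have "\<dots> < exp (z - 1) ^ a * exp (w - 1) ^ b"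
      using zw z_less 3 by (intro mult_strict_right_mono power_strict_mono) auto
    also have "\<dots> = exp (a * (z - 1) + b * (w - 1))"
      by (simp add: exp_add exp_of_nat_mult)
    finally have "z ^ a * w ^ b < 1" using cancel by simp
    then have "x0 ^ a * (1 - x0) ^ b * (z ^ a * w ^ b) < x0 ^ a * (1 - x0) ^ b"
      using x0 by simp
    moreover have "x0 ^ a * (1 - x0) ^ b * (z ^ a * w ^ b) = (x0 * z) ^ a * ((1 - x0) * w) ^ b"
      by (simp add: power_mult_distrib)
    moreover have "x0 * z = x" "(1 - x0) * w = 1 - x"
      using x0 by (simp_all add: z_def w_def)
    ultimately show ?thesis by (simp add: x0_def N_def)
  qed
qed

lemma is_arg_max_bernoulli_iff:
  fixes x :: real and a b :: nat
  assumes ab: "a + b > 0"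
  shows "is_arg_max (\<lambda>x. x ^ a * (1 - x) ^ b) (\<lambda>x. x \<in> {0..1}) x \<longleftrightarrow> x = a / (a + b)"
proof -
  have mem: "a / (a + b) \<in> {0..1 :: real}" using ab by (auto simp: divide_le_eq)
  have "\<not> y ^ a * (1 - y) ^ b > (a / (a + b)) ^ a * (1 - a / (a + b)) ^ b"
    if "y \<in> {0..1}" for y :: real
    using bernoulli_likelihood_less[of y a b] that ab by (cases "y = a / (a + b)") auto
  moreover have "x = a / (a + b)"
    if "is_arg_max (\<lambda>x. x ^ a * (1 - x) ^ b) (\<lambda>x. x \<in> {0..1}) x"
    using that bernoulli_likelihood_less[of x a b] mem ab unfolding is_arg_max_def by auto
  ultimately show ?thesis using mem unfolding is_arg_max_def by blast
qed

lemma bernoulli_likelihood_mode_pos: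
  fixes a b :: nat
  assumes "a + b > 0"
  shows "(a / (a + b) :: real) ^ a * (1 - a / (a + b)) ^ b > 0"
  using assms by (cases "a = 0"; cases "b = 0") (auto simp: field_simps)

text \<open>
  A maximum of a product of nonnegative functions of separate variables is attained exactly at
  the pairs of maximizers, as long as neither maximum vanishes: with a zero factor the
  other variable would be arbitrary.
\<close>

lemma is_arg_max_mult_iff:
  fixes f :: "'a \<Rightarrow> real" and g :: "'b \<Rightarrow> real"
  assumes nonneg: "\<And>x. x \<in> A \<Longrightarrow> f x \<ge> 0" "\<And>y. y \<in> B \<Longrightarrow> g y \<ge> 0"
    and x0: "is_arg_max f (\<lambda>x. x \<in> A) x0" "f x0 > 0"
    and y0: "is_arg_max g (\<lambda>y. y \<in> B) y0" "g y0 > 0"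
  shows "is_arg_max (\<lambda>(x, y). f x * g y) (\<lambda>z. z \<in> A \<times> B) (x, y) \<longleftrightarrow>
    is_arg_max f (\<lambda>x. x \<in> A) x \<and> is_arg_max g (\<lambda>y. y \<in> B) y"
proof
  assume *: "is_arg_max (\<lambda>(x, y). f x * g y) (\<lambda>z. z \<in> A \<times> B) (x, y)"
  then have mem: "x \<in> A" "y \<in> B" by (auto simp: is_arg_max_def)
  have le: "f x \<le> f x0" "g y \<le> g y0"
    using mem x0 y0 by (auto simp: is_arg_max_def not_less)
  have max: "f x0 * g y0 \<le> f x * g y"
    using * x0 y0 by (auto simp: is_arg_max_def not_less)
  also have "\<dots> \<le> f x * g y0" using le nonneg mem by (intro mult_left_mono) auto
  finally have fx: "f x = f x0" using y0(2) le by simp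
  have "f x * g y \<le> f x0 * g y" using le nonneg mem by (intro mult_right_mono) auto
  with max have "f x0 * g y0 \<le> f x0 * g y" by linarith
  then have "g y = g y0" using x0(2) le by simp
  with fx show "is_arg_max f (\<lambda>x. x \<in> A) x \<and> is_arg_max g (\<lambda>y. y \<in> B) y"
    using mem x0 y0 by (auto simp: is_arg_max_def)
next
  assume "is_arg_max f (\<lambda>x. x \<in> A) x \<and> is_arg_max g (\<lambda>y. y \<in> B) y"
  then have mem: "x \<in> A" "y \<in> B" and le: "\<And>x'. x' \<in> A \<Longrightarrow> f x' \<le> f x" "\<And>y'. y' \<in> B \<Longrightarrow> g y' \<le> g y"
    by (auto simp: is_arg_max_def not_less)
  have "f x' * g y' \<le> f x * g y" if "x' \<in> A" "y' \<in> B" for x' y'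
    using that mem le nonneg by (intro mult_mono) auto
  then show "is_arg_max (\<lambda>(x, y). f x * g y) (\<lambda>z. z \<in> A \<times> B) (x, y)"
    using mem by (auto simp: is_arg_max_def not_less)
qed

section \<open>Sufficiency from fibrewise constant probabilities\<close>

text \<open>
  This is the factorization criterion in the case where the factor that does not depend on the
  parameter is constant on the common sample space \<open>S\<close>. Conditioning on an attained value \<open>\<tau>\<close> then
  gives the uniform distribution on the fibre of \<open>\<tau>\<close> in \<open>S\<close>. A member \<open>P \<theta>\<close> may have a smaller
  support than \<open>S\<close>, but its support contains the whole fibre as soon as it meets it.
\<close>

lemma sufficient_statisticI:
  assumes S: "finite S" "\<And>\<theta>. \<theta> \<in> \<Theta> \<Longrightarrow> set_pmf (P \<theta>) \<subseteq> S"
    and g: "\<And>\<theta> x. \<theta> \<in> \<Theta> \<Longrightarrow> x \<in> S \<Longrightarrow> pmf (P \<theta>) x = g \<theta> (T x)"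
  shows "sufficient_statistic P \<Theta> T"
  unfolding sufficient_statistic_def
proof (intro exI ballI)
  fix \<theta> \<tau> assume \<theta>: "\<theta> \<in> \<Theta>" and "\<tau> \<in> T ` set_pmf (P \<theta>)"
  then obtain x0 where x0: "x0 \<in> set_pmf (P \<theta>)" "T x0 = \<tau>" by auto
  define F where "F = {x \<in> S. T x = \<tau>}"
  have F: "finite F" "F \<noteq> {}" using S \<theta> x0 by (auto simp: F_def)
  have const: "pmf (P \<theta>) x = g \<theta> \<tau>" if "x \<in> F" for x
    using that g \<theta> by (auto simp: F_def)
  have "x0 \<in> F" using S \<theta> x0 by (auto simp: F_def)
  then have pos: "g \<theta> \<tau> > 0" using const x0 by (metis pmf_positive)
  have "measure_pmf.prob (P \<theta>) {x. T x = \<tau>} = measure_pmf.prob (P \<theta>) F"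
    using S(2)[OF \<theta>] by (intro measure_prob_cong_0) (auto simp: F_def set_pmf_eq)
  also have "\<dots> = card F * g \<theta> \<tau>"
    using F const by (simp add: measure_measure_pmf_finite)
  finally have prob: "measure_pmf.prob (P \<theta>) {x. T x = \<tau>} = card F * g \<theta> \<tau>" .
  have "set_pmf (P \<theta>) \<inter> {x. T x = \<tau>} \<noteq> {}" using x0 by auto
  then have cond: "pmf (cond_pmf (P \<theta>) {x. T x = \<tau>}) x =
      (if T x = \<tau> then pmf (P \<theta>) x / (card F * g \<theta> \<tau>) else 0)" for x
    by (simp add: pmf_cond prob)
  have "cond_pmf (P \<theta>) {x. T x = \<tau>} = pmf_of_set F"
  proof (rule pmf_eqI)
    fix x
    show "pmf (cond_pmf (P \<theta>) {x. T x = \<tau>}) x = pmf (pmf_of_set F) x"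
    proof (cases "x \<in> F")
      case True
      then show ?thesis using F pos const by (simp add: cond) (simp add: F_def)
    next
      case False
      then have "T x \<noteq> \<tau> \<or> pmf (P \<theta>) x = 0"
        using S(2)[OF \<theta>] by (auto simp: F_def set_pmf_eq)
      then show ?thesis using False F by (auto simp: cond)
    qed
  qed
  then show "cond_pmf (P \<theta>) {x. T x = \<tau>} = pmf_of_set {x \<in> S. T x = \<tau>}"
    by (simp add: F_def)
qed

section \<open>Jumps and marginal counts\<close>

definition jump :: "real \<Rightarrow> (nat \<Rightarrow> nat \<Rightarrow> real) \<Rightarrow> nat \<Rightarrow> nat \<Rightarrow> bool" where
  "jump \<delta> X i s \<longleftrightarrow> X i s - X i (s - 1) = \<delta>"

definition step_count :: "real \<Rightarrow> nat \<Rightarrow> (nat \<Rightarrow> nat \<Rightarrow> real) \<Rightarrow> nat \<Rightarrow> nat" where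
  "step_count \<delta> n X s = card {i \<in> {1..n}. jump \<delta> X i s}"

definition level_sum :: "nat \<Rightarrow> (nat \<times> nat \<Rightarrow> nat) \<Rightarrow> nat \<Rightarrow> nat" where
  "level_sum K C t = (\<Sum>k = 0..K. k * C (t, k))"

lemma card_filter_eq_sum_of_bool: "finite A \<Longrightarrow> card {x \<in> A. P x} = (\<Sum>x\<in>A. of_bool (P x))"
  by (simp add: of_bool_def sum.If_cases Int_def)

lemma step_count_le: "step_count \<delta> n X s \<le> n"
  unfolding step_count_def by (rule order.trans[OF card_mono[of "{1..n}"]]) auto

lemma sum_mult_card_fibre:
  fixes f :: "'a \<Rightarrow> nat"
  assumes "finite A" "\<And>x. x \<in> A \<Longrightarrow> f x \<le> K"
  shows "(\<Sum>k = 0..K. k * card {x \<in> A. f x = k}) = (\<Sum>x\<in>A. f x)"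
proof -
  have "(\<Sum>k = 0..K. k * card {x \<in> A. f x = k}) = (\<Sum>k = 0..K. \<Sum>x\<in>A. k * of_bool (f x = k))"
    by (simp only: card_filter_eq_sum_of_bool[OF assms(1)] sum_distrib_left)
  also have "\<dots> = (\<Sum>x\<in>A. \<Sum>k = 0..K. k * of_bool (f x = k))" by (rule sum.swap)
  also have "\<dots> = (\<Sum>x\<in>A. f x)"
  proof (rule sum.cong)
    fix x assume "x \<in> A"
    have "(\<Sum>k = 0..K. k * of_bool (f x = k)) = (\<Sum>k = 0..K. if f x = k then k else 0)"
      by (rule sum.cong) auto
    then show "(\<Sum>k = 0..K. k * of_bool (f x = k)) = f x"
      using assms(2)[OF \<open>x \<in> A\<close>] by simp
  qed simp
  finally show ?thesis .
qed

lemma london_data_level: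
  assumes X: "london_data c \<delta> m n X" and i: "i \<in> {1..n}" and "t \<le> m"
  shows "X i t = c + \<delta> * real (\<Sum>s = 1..t. of_bool (jump \<delta> X i s))"
  using \<open>t \<le> m\<close>
proof (induction t)
  case 0
  then show ?case using X i by (auto simp: london_data_def)
next
  case (Suc t)
  have "Suc t \<in> {1..m}" using Suc.prems by simp
  then have "X i (Suc t) - X i t \<in> {0, \<delta>}"
    using X i unfolding london_data_def by (metis diff_Suc_1)
  then have "X i (Suc t) = X i t + \<delta> * of_bool (jump \<delta> X i (Suc t))"
    by (auto simp: jump_def)
  then show ?case using Suc by (simp add: algebra_simps)
qed

text \<open>
  The level of a trajectory at time \<open>t\<close> is its number of jumps up to \<open>t\<close>. The sum of the levels over
  the sample is thus a double count of pairs of a trajectory and a jump. Both upper limits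
  \<open>t\<close> and \<open>m\<close> for the level occur below, and any limit from \<open>t\<close> on gives the same sum.
\<close>

lemma level_sum_eq_jumps:
  assumes X: "london_data c \<delta> m n X" and "\<delta> \<noteq> 0" "t \<le> m" "t \<le> K"
  shows "(\<Sum>k = 0..K. k * marginal_count c \<delta> n X t k) = (\<Sum>s = 1..t. step_count \<delta> n X s)"
proof -
  define f where "f i = (\<Sum>s = 1..t. of_bool (jump \<delta> X i s) :: nat)" for i
  have f_le: "f i \<le> K" for i
  proof -
    have "f i \<le> (\<Sum>s = 1..t. 1)" unfolding f_def by (rule sum_mono) simp
    then show ?thesis using \<open>t \<le> K\<close> by simp
  qed
  have "marginal_count c \<delta> n X t k = card {i \<in> {1..n}. f i = k}" for k
    unfolding marginal_count_def
    using london_data_level[OF X _ \<open>t \<le> m\<close>] \<open>\<delta> \<noteq> 0\<close>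
    by (intro arg_cong[where f = card]) (auto simp: f_def simp del: of_nat_sum)
  then have "(\<Sum>k = 0..K. k * marginal_count c \<delta> n X t k) = (\<Sum>i = 1..n. f i)"
    using sum_mult_card_fibre[of "{1..n}" f K] f_le by simp
  also have "\<dots> = (\<Sum>s = 1..t. \<Sum>i = 1..n. of_bool (jump \<delta> X i s))"
    unfolding f_def by (rule sum.swap)
  also have "\<dots> = (\<Sum>s = 1..t. step_count \<delta> n X s)"
    by (simp only: step_count_def card_filter_eq_sum_of_bool finite_atLeastAtMost)
  finally show ?thesis .
qed

lemma step_count_eq_level_sum_diff:
  assumes X: "london_data c \<delta> m n X" and "\<delta> \<noteq> 0" "s \<in> {1..m}"
  shows "step_count \<delta> n X s =
    level_sum m (marginal_counts c \<delta> m n X) s - level_sum m (marginal_counts c \<delta> m n X) (s - 1)"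
proof -
  have lev: "level_sum m (marginal_counts c \<delta> m n X) t = (\<Sum>r = 1..t. step_count \<delta> n X r)"
    if "t \<le> m" for t
    using level_sum_eq_jumps[OF X \<open>\<delta> \<noteq> 0\<close> that that] that
    by (simp add: level_sum_def marginal_counts_def)
  obtain r where "s = Suc r" using assms(3) by (cases s) auto
  then show ?thesis using assms(3) by (simp add: lev)
qed

section \<open>The likelihood\<close>

lemma london_path_eq_iff:
  assumes "x 0 = c" and inc: "\<And>s. s \<in> {1..m} \<Longrightarrow> x s - x (s - 1) \<in> {0, \<delta>}" and "\<delta> \<noteq> 0"
  shows "(\<forall>s\<in>{0..m}. london_path c \<delta> \<omega> s = x s) \<longleftrightarrow>
    (\<forall>s\<in>{1..m}. \<omega> s \<longleftrightarrow> x s - x (s - 1) = \<delta>)"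
proof
  assume eq: "\<forall>s\<in>{0..m}. london_path c \<delta> \<omega> s = x s"
  show "\<forall>s\<in>{1..m}. \<omega> s \<longleftrightarrow> x s - x (s - 1) = \<delta>"
  proof
    fix s assume s: "s \<in> {1..m}"
    then obtain r where r: "s = Suc r" by (cases s) auto
    have "london_path c \<delta> \<omega> s = x s" using eq s by simp
    moreover have "london_path c \<delta> \<omega> r = x r" using eq s r by simp
    ultimately have "x s = x r + (if \<omega> s then \<delta> else 0)" using r by (metis london_path.simps(2))
    then show "\<omega> s \<longleftrightarrow> x s - x (s - 1) = \<delta>" using r \<open>\<delta> \<noteq> 0\<close> by (cases "\<omega> s") auto
  qed
next
  assume eq: "\<forall>s\<in>{1..m}. \<omega> s \<longleftrightarrow> x s - x (s - 1) = \<delta>"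
  have "london_path c \<delta> \<omega> s = x s" if "s \<le> m" for s
    using that
  proof (induction s)
    case (Suc s)
    have s: "Suc s \<in> {1..m}" using Suc.prems by simp
    have "\<omega> (Suc s) \<longleftrightarrow> x (Suc s) - x s = \<delta>" using eq s by force
    moreover have "x (Suc s) - x s \<in> {0, \<delta>}" using inc[OF s] by simp
    ultimately show ?case using Suc by auto
  qed (use assms in simp)
  then show "\<forall>s\<in>{0..m}. london_path c \<delta> \<omega> s = x s" by simp
qed

lemma prob_london_pmf:
  assumes "x 0 = c" "\<And>s. s \<in> {1..m} \<Longrightarrow> x s - x (s - 1) \<in> {0, \<delta>}" "\<delta> \<noteq> 0"
    and pq: "p \<in> {0..1}" "q \<in> {0..1}"
  shows "measure_pmf.prob (london_pmf c \<delta> m p q ts) {y. \<forall>s\<in>{0..m}. y s = x s} =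
    (\<Prod>s = 1..m. if x s - x (s - 1) = \<delta> then step_prob p q ts s else 1 - step_prob p q ts s)"
proof -
  have "measure_pmf.prob (london_pmf c \<delta> m p q ts) {y. \<forall>s\<in>{0..m}. y s = x s} =
      measure_pmf.prob (Pi_pmf {1..m} False (\<lambda>s. bernoulli_pmf (step_prob p q ts s)))
        {\<omega>. \<forall>s\<in>{0..m}. london_path c \<delta> \<omega> s = x s}"
    by (simp add: london_pmf_def vimage_def)
  also have "{\<omega>. \<forall>s\<in>{0..m}. london_path c \<delta> \<omega> s = x s} =
      Pi {1..m} (\<lambda>s. {x s - x (s - 1) = \<delta>})"
    using london_path_eq_iff[of x c m \<delta>, OF assms(1-3)] by (auto simp: Pi_def)
  also have "measure_pmf.prob (Pi_pmf {1..m} False (\<lambda>s. bernoulli_pmf (step_prob p q ts s))) \<dots> =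
      (\<Prod>s = 1..m. pmf (bernoulli_pmf (step_prob p q ts s)) (x s - x (s - 1) = \<delta>))"
    by (simp add: measure_Pi_pmf_Pi measure_pmf_single)
  also have "\<dots> = (\<Prod>s = 1..m. if x s - x (s - 1) = \<delta>
      then step_prob p q ts s else 1 - step_prob p q ts s)"
    using pq by (intro prod.cong) (auto simp: step_prob_def)
  finally show ?thesis .
qed

lemma prod_if_const:
  fixes x y :: "'b :: comm_monoid_mult"
  assumes "finite A"
  shows "(\<Prod>i\<in>A. if P i then x else y) = x ^ card {i \<in> A. P i} * y ^ (card A - card {i \<in> A. P i})"
proof -
  have "A \<inter> {i. P i} = {i \<in> A. P i}" "A \<inter> - {i. P i} = A - {i \<in> A. P i}" by auto
  moreover have "card (A - {i \<in> A. P i}) = card A - card {i \<in> A. P i}"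
    using assms by (intro card_Diff_subset) auto
  ultimately show ?thesis using assms by (simp only: prod.If_cases prod_constant)
qed

text \<open>
  The trajectories are independent, so the likelihood is a product over trajectories of products
  over steps. In the other order, the factors of each step are powers of only two numbers.
\<close>

lemma lik_eq_prod_step_count:
  assumes X: "london_data c \<delta> m n X" and "\<delta> \<noteq> 0" and pq: "p \<in> {0..1}" "q \<in> {0..1}"
  shows "lik c \<delta> m n X p q ts =
    (\<Prod>s = 1..m. step_prob p q ts s ^ step_count \<delta> n X s *
       (1 - step_prob p q ts s) ^ (n - step_count \<delta> n X s))"
proof -
  have "{Y. \<forall>i\<in>{1..n}. \<forall>s\<in>{0..m}. Y i s = X i s} =
      Pi {1..n} (\<lambda>i. {y. \<forall>s\<in>{0..m}. y s = X i s})"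
    by (auto simp: Pi_def)
  then have "lik c \<delta> m n X p q ts =
      (\<Prod>i = 1..n. measure_pmf.prob (london_pmf c \<delta> m p q ts) {y. \<forall>s\<in>{0..m}. y s = X i s})"
    by (simp add: lik_def london_sample_pmf_def measure_Pi_pmf_Pi)
  also have "\<dots> = (\<Prod>i = 1..n. \<Prod>s = 1..m. if jump \<delta> X i s
      then step_prob p q ts s else 1 - step_prob p q ts s)"
    unfolding jump_def using X \<open>\<delta> \<noteq> 0\<close> pq
    by (intro prod.cong refl prob_london_pmf) (auto simp: london_data_def)
  also have "\<dots> = (\<Prod>s = 1..m. \<Prod>i = 1..n. if jump \<delta> X i s
      then step_prob p q ts s else 1 - step_prob p q ts s)"
    by (rule prod.swap)
  finally show ?thesis by (simp add: prod_if_const step_count_def)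
qed

lemma lik_eq_two_bernoulli:
  assumes X: "london_data c \<delta> m n X" and "\<delta> \<noteq> 0" and pq: "p \<in> {0..1}" "q \<in> {0..1}"
    and t: "t \<in> {1..m}"
  defines "N \<equiv> step_count \<delta> n X"
  shows "lik c \<delta> m n X p q t =
    (p ^ sum N {1..t - 1} * (1 - p) ^ (n * (t - 1) - sum N {1..t - 1})) *
    (q ^ sum N {t..m} * (1 - q) ^ (n * (m + 1 - t) - sum N {t..m}))"
proof -
  have group: "(\<Prod>s\<in>A. x ^ N s * (1 - x) ^ (n - N s)) =
      x ^ sum N A * (1 - x) ^ (n * card A - sum N A)" for x :: real and A
  proof -
    have "(\<Sum>s\<in>A. n - N s) = n * card A - sum N A"
      using sum_subtractf_nat[of A N "\<lambda>_. n"] by (simp add: N_def step_count_le mult.commute)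
    then show ?thesis by (simp add: prod.distrib flip: power_sum)
  qed
  have split: "{1..m} = {1..t - 1} \<union> {t..m}" using t by auto
  have "lik c \<delta> m n X p q t =
      (\<Prod>s = 1..t - 1. step_prob p q t s ^ N s * (1 - step_prob p q t s) ^ (n - N s)) *
      (\<Prod>s = t..m. step_prob p q t s ^ N s * (1 - step_prob p q t s) ^ (n - N s))"
    unfolding lik_eq_prod_step_count[OF assms(1-4)] split N_def[symmetric]
    using t by (intro prod.union_disjoint) auto
  also have "(\<Prod>s = 1..t - 1. step_prob p q t s ^ N s * (1 - step_prob p q t s) ^ (n - N s)) =
      (\<Prod>s = 1..t - 1. p ^ N s * (1 - p) ^ (n - N s))"
    using t by (intro prod.cong) (auto simp: step_prob_def)
  also have "(\<Prod>s = t..m. step_prob p q t s ^ N s * (1 - step_prob p q t s) ^ (n - N s)) =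
      (\<Prod>s = t..m. q ^ N s * (1 - q) ^ (n - N s))"
    by (intro prod.cong) (auto simp: step_prob_def)
  finally show ?thesis by (simp add: group)
qed

text \<open>
  Random trajectories are constant after time \<open>m\<close>, so a sample in the support is determined by
  the observations up to \<open>m\<close> and the event in the likelihood is a single sample.
\<close>

definition london_sample_space :: "real \<Rightarrow> real \<Rightarrow> nat \<Rightarrow> nat \<Rightarrow> (nat \<Rightarrow> nat \<Rightarrow> real) set" where
  "london_sample_space c \<delta> m n =
     PiE_dflt {1..n} undefined (\<lambda>_. london_path c \<delta> ` PiE_dflt {1..m} False (\<lambda>_. UNIV))"

lemma finite_london_sample_space: "finite (london_sample_space c \<delta> m n)"
  unfolding london_sample_space_def by (intro finite_PiE_dflt finite_imageI) auto

lemma set_london_sample_pmf_subset: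
  "set_pmf (london_sample_pmf c \<delta> m n p q ts) \<subseteq> london_sample_space c \<delta> m n"
proof -
  have "set_pmf (london_pmf c \<delta> m p q ts) \<subseteq> london_path c \<delta> ` PiE_dflt {1..m} False (\<lambda>_. UNIV)"
    unfolding london_pmf_def set_map_pmf
    by (intro image_mono) (auto simp: set_Pi_pmf PiE_dflt_def)
  moreover have "set_pmf (london_sample_pmf c \<delta> m n p q ts) =
      PiE_dflt {1..n} undefined (\<lambda>_. set_pmf (london_pmf c \<delta> m p q ts))"
    unfolding london_sample_pmf_def by (simp add: set_Pi_pmf o_def)
  ultimately show ?thesis
    unfolding london_sample_space_def PiE_dflt_def[of "{1..n}"] by blast
qed

lemma london_data_sample_space:
  assumes "X \<in> london_sample_space c \<delta> m n"
  shows "london_data c \<delta> m n X"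
  unfolding london_data_def
proof (intro ballI conjI)
  fix i assume "i \<in> {1..n}"
  then obtain \<omega> where \<omega>: "X i = london_path c \<delta> \<omega>"
    using assms by (auto simp: london_sample_space_def PiE_dflt_def)
  then show "X i 0 = c" by simp
  fix s assume "s \<in> {1..m}"
  then show "X i s - X i (s - 1) \<in> {0, \<delta>}" using \<omega> by (cases s) auto
qed

lemma london_path_stopped:
  assumes "\<omega> \<in> PiE_dflt {1..m} False (\<lambda>_. UNIV)"
  shows "london_path c \<delta> \<omega> s = london_path c \<delta> \<omega> (min s m)"
proof (induction s)
  case (Suc s)
  show ?case
  proof (cases "Suc s \<le> m")
    case False
    then have "\<not> \<omega> (Suc s)" using assms by (simp add: PiE_dflt_def)
    moreover have "min s m = m" "min (Suc s) m = m" using False by simp_all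
    ultimately show ?thesis using Suc by (simp only: london_path.simps if_False add_0_right)
  qed simp
qed simp

lemma london_sample_space_stopped:
  assumes X: "X \<in> london_sample_space c \<delta> m n" and "i \<in> {1..n}"
  shows "X i s = X i (min s m)"
proof -
  have "X i \<in> london_path c \<delta> ` PiE_dflt {1..m} False (\<lambda>_. UNIV)"
    using assms unfolding london_sample_space_def PiE_dflt_def[of "{1..n}"] by blast
  then obtain \<omega> where "X i = london_path c \<delta> \<omega>" "\<omega> \<in> PiE_dflt {1..m} False (\<lambda>_. UNIV)"
    by (rule imageE)
  then show ?thesis using london_path_stopped[of \<omega> m c \<delta> s] by simp
qed

lemma london_sample_space_eqI:
  assumes X: "X \<in> london_sample_space c \<delta> m n" and Y: "Y \<in> london_sample_space c \<delta> m n"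
    and eq: "\<And>i s. i \<in> {1..n} \<Longrightarrow> s \<le> m \<Longrightarrow> Y i s = X i s"
  shows "Y = X"
proof
  fix i
  show "Y i = X i"
  proof (cases "i \<in> {1..n}")
    case True
    have "Y i s = X i s" for s
      unfolding london_sample_space_stopped[OF X True, of s]
        london_sample_space_stopped[OF Y True, of s]
      by (rule eq[OF True]) simp
    then show ?thesis by (rule ext)
  next
    case False
    have "Z i = undefined" if "Z \<in> london_sample_space c \<delta> m n" for Z
      using that False unfolding london_sample_space_def PiE_dflt_def[of "{1..n}"] by simp
    then show ?thesis using X Y by simp
  qed
qed

lemma pmf_london_sample:
  assumes "X \<in> london_sample_space c \<delta> m n"
  shows "pmf (london_sample_pmf c \<delta> m n p q ts) X = lik c \<delta> m n X p q ts"
proof -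
  let ?P = "london_sample_pmf c \<delta> m n p q ts"
  let ?E = "{Y. \<forall>i\<in>{1..n}. \<forall>s\<in>{0..m}. Y i s = X i s}"
  have "Y = X" if Y: "Y \<in> ?E" "Y \<in> set_pmf ?P" for Y
  proof (rule london_sample_space_eqI[OF assms])
    show "Y \<in> london_sample_space c \<delta> m n" using Y(2) set_london_sample_pmf_subset by blast
  qed (use Y(1) in auto)
  then have E: "?E \<inter> set_pmf ?P = {X} \<inter> set_pmf ?P" by auto
  have "measure_pmf.prob ?P ?E = measure_pmf.prob ?P (?E \<inter> set_pmf ?P)"
    by (rule measure_Int_set_pmf[symmetric])
  also have "\<dots> = measure_pmf.prob ?P {X}"
    unfolding E by (rule measure_Int_set_pmf)
  finally show ?thesis by (simp add: lik_def measure_pmf_single)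
qed

section \<open>Sufficiency and maximum likelihood estimates\<close>

definition count_lik ::
  "nat \<Rightarrow> nat \<Rightarrow> (nat \<times> nat \<Rightarrow> nat) \<Rightarrow> real \<Rightarrow> real \<Rightarrow> nat \<Rightarrow> real" where
  "count_lik m n C p q ts =
     (\<Prod>s = 1..m. let N = level_sum m C s - level_sum m C (s - 1)
        in step_prob p q ts s ^ N * (1 - step_prob p q ts s) ^ (n - N))"

lemma lik_eq_count_lik:
  assumes "london_data c \<delta> m n X" "\<delta> \<noteq> 0" "p \<in> {0..1}" "q \<in> {0..1}"
  shows "lik c \<delta> m n X p q ts = count_lik m n (marginal_counts c \<delta> m n X) p q ts"
  unfolding lik_eq_prod_step_count[OF assms] count_lik_def Let_def
  using step_count_eq_level_sum_diff[OF assms(1,2)] by (intro prod.cong) auto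

lemma sufficient_marginal_counts:
  assumes "\<delta> \<noteq> 0"
  shows "sufficient_statistic (\<lambda>(p, q, ts). london_sample_pmf c \<delta> m n p q ts)
    ({0..1} \<times> {0..1} \<times> {1..m}) (marginal_counts c \<delta> m n)"
proof (rule sufficient_statisticI
    [where S = "london_sample_space c \<delta> m n" and g = "\<lambda>(p, q, ts) C. count_lik m n C p q ts"])
  show "finite (london_sample_space c \<delta> m n)" by (rule finite_london_sample_space)
next
  fix \<theta> :: "real \<times> real \<times> nat"
  show "set_pmf (case \<theta> of (p, q, ts) \<Rightarrow> london_sample_pmf c \<delta> m n p q ts) \<subseteq>
      london_sample_space c \<delta> m n"
    using set_london_sample_pmf_subset by (cases \<theta>) fastforce
next
  fix \<theta> :: "real \<times> real \<times> nat" and X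
  assume "\<theta> \<in> {0..1} \<times> {0..1} \<times> {1..m}" and X: "X \<in> london_sample_space c \<delta> m n"
  then obtain p q ts where "\<theta> = (p, q, ts)" "p \<in> {0..1}" "q \<in> {0..1}" by (cases \<theta>) auto
  then show "pmf (case \<theta> of (p, q, ts) \<Rightarrow> london_sample_pmf c \<delta> m n p q ts) X =
      (case \<theta> of (p, q, ts) \<Rightarrow> \<lambda>C. count_lik m n C p q ts) (marginal_counts c \<delta> m n X)"
    using lik_eq_count_lik[OF london_data_sample_space[OF X] assms] pmf_london_sample[OF X] by simp
qed

lemma p_hat_eq:
  assumes "london_data c \<delta> m n X" "\<delta> \<noteq> 0" "t \<in> {1..m}"
  shows "p_hat c \<delta> n X t = real (\<Sum>s = 1..t - 1. step_count \<delta> n X s) / real (n * (t - 1))"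
proof -
  have "t - 1 \<le> m" using assms(3) by auto
  note lev = level_sum_eq_jumps[OF assms(1,2) this order.refl, symmetric]
  show ?thesis
    unfolding lev using assms(3)
    by (simp add: p_hat_def of_nat_diff mult.commute flip: sum_divide_distrib)
qed

lemma q_hat_eq:
  assumes X: "london_data c \<delta> m n X" and "\<delta> \<noteq> 0" and t: "t \<in> {1..m}"
  shows "q_hat c \<delta> m n X t = real (\<Sum>s = t..m. step_count \<delta> n X s) / real (n * (m + 1 - t))"
proof -
  let ?N = "step_count \<delta> n X"
  have "t - 1 \<le> m" using t by auto
  have "{1..m} = {1..t - 1} \<union> {t..m}" using t by auto
  then have "sum ?N {1..m} = sum ?N {1..t - 1} + sum ?N {t..m}"
    using t by (simp only:) (intro sum.union_disjoint; auto)
  then have "real (sum ?N {t..m}) = real (sum ?N {1..m}) - real (sum ?N {1..t - 1})" by simp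
  also have "\<dots> = real (\<Sum>k = 0..m. k * marginal_count c \<delta> n X m k) -
      real (\<Sum>k = 0..m. k * marginal_count c \<delta> n X (t - 1) k)"
    using level_sum_eq_jumps[OF X \<open>\<delta> \<noteq> 0\<close> order.refl order.refl]
      level_sum_eq_jumps[OF X \<open>\<delta> \<noteq> 0\<close> \<open>t - 1 \<le> m\<close> \<open>t - 1 \<le> m\<close>]
    by (simp only:)
  also have "\<dots> = (\<Sum>k = 0..m. real k *
      (real (marginal_count c \<delta> n X m k) - real (marginal_count c \<delta> n X (t - 1) k)))"
    by (simp add: right_diff_distrib sum_subtractf)
  finally have diff: "real (sum ?N {t..m}) = \<dots>" .
  have "real (m + 1 - t) = real m - real t + 1" using t by (simp add: of_nat_diff)
  then show ?thesis
    unfolding diff q_hat_def of_nat_mult by (simp add: mult.commute flip: sum_divide_distrib)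
qed

lemma MLE_set_eq:
  assumes X: "london_data c \<delta> m n X" and "\<delta> \<noteq> 0" "n \<ge> 1" and t: "t \<in> {1..m}"
  shows "MLE_set c \<delta> m n X t =
    (if t \<ge> 2 then {p_hat c \<delta> n X t} else {0..1}) \<times> {q_hat c \<delta> m n X t}"
proof -
  define a where "a = (\<Sum>s = 1..t - 1. step_count \<delta> n X s)"
  define b where "b = (\<Sum>s = t..m. step_count \<delta> n X s)"
  define a' where "a' = n * (t - 1) - a"
  define b' where "b' = n * (m + 1 - t) - b"
  have sum_le: "sum (step_count \<delta> n X) A \<le> n * card A" for A
    using sum_mono[of A "step_count \<delta> n X" "\<lambda>_. n"] step_count_le by (simp add: mult.commute)
  have aa': "a + a' = n * (t - 1)" and bb': "b + b' = n * (m + 1 - t)"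
    using sum_le[of "{1..t - 1}"] sum_le[of "{t..m}"] by (auto simp: a_def a'_def b_def b'_def)
  have p_hat: "p_hat c \<delta> n X t = a / (a + a')"
    unfolding aa' using p_hat_eq[OF X \<open>\<delta> \<noteq> 0\<close> t] by (simp only: a_def)
  have q_hat: "q_hat c \<delta> m n X t = b / (b + b')"
    unfolding bb' using q_hat_eq[OF X \<open>\<delta> \<noteq> 0\<close> t] by (simp only: b_def)
  define f where "f p = p ^ a * (1 - p) ^ a'" for p :: real
  define g where "g q = q ^ b * (1 - q) ^ b'" for q :: real
  have lik: "lik c \<delta> m n X p q t = f p * g q" if "p \<in> {0..1}" "q \<in> {0..1}" for p q
    using lik_eq_two_bernoulli[OF X \<open>\<delta> \<noteq> 0\<close> that t]
    by (simp only: f_def g_def a_def b_def a'_def b'_def)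
  have b_pos: "b + b' > 0" using bb' \<open>n \<ge> 1\<close> t by simp
  have g_max: "is_arg_max g (\<lambda>q. q \<in> {0..1}) q \<longleftrightarrow> q = q_hat c \<delta> m n X t" for q
    unfolding g_def q_hat using is_arg_max_bernoulli_iff[OF b_pos] by simp
  have g_pos: "g (q_hat c \<delta> m n X t) > 0"
    unfolding g_def q_hat using bernoulli_likelihood_mode_pos[OF b_pos] by simp
  let ?A = "if t \<ge> 2 then {p_hat c \<delta> n X t} else {0..1}"
  have f_max: "is_arg_max f (\<lambda>p. p \<in> {0..1}) p \<longleftrightarrow> p \<in> ?A" for p
  proof (cases "t \<ge> 2")
    case True
    then have "a + a' > 0" using aa' \<open>n \<ge> 1\<close> by simp
    then show ?thesis
      unfolding f_def p_hat using is_arg_max_bernoulli_iff[of a a'] True by simp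
  next
    \<comment> \<open>No step is governed by \<open>p\<close>, so \<open>f\<close> is the empty product.\<close>
    case False
    then have "a = 0" "a' = 0" using aa' t by auto
    then show ?thesis using False by (simp add: f_def is_arg_max_def)
  qed
  obtain p0 where p0: "p0 \<in> ?A" "f p0 > 0"
  proof (cases "t \<ge> 2")
    case True
    then have "a + a' > 0" using aa' \<open>n \<ge> 1\<close> by simp
    then have "f (p_hat c \<delta> n X t) > 0"
      unfolding f_def p_hat using bernoulli_likelihood_mode_pos[of a a'] by simp
    then show ?thesis using that True by simp
  next
    case False
    then have "a = 0" "a' = 0" using aa' t by auto
    then show ?thesis using that[of 0] False by (simp add: f_def)
  qed
  have nonneg: "f x \<ge> 0" "g x \<ge> 0" if "x \<in> {0..1}" for x
    using that by (auto simp: f_def g_def)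
  have "is_arg_max (\<lambda>(p, q). lik c \<delta> m n X p q t) (\<lambda>x. x \<in> {0..1} \<times> {0..1}) (p, q) \<longleftrightarrow>
      is_arg_max (\<lambda>(p, q). f p * g q) (\<lambda>x. x \<in> {0..1} \<times> {0..1}) (p, q)" for p q
    unfolding is_arg_max_def using lik by auto
  also have "\<dots> p q \<longleftrightarrow> p \<in> ?A \<and> q = q_hat c \<delta> m n X t" for p q
    using is_arg_max_mult_iff[of "{0..1}" f "{0..1}" g p0 "q_hat c \<delta> m n X t" p q]
      nonneg f_max g_max p0 g_pos by blast
  finally show ?thesis unfolding MLE_set_def by auto
qed

theorem theorem5:
  fixes c \<delta> :: real and m n :: nat
  assumes "c \<ge> 0" and "\<delta> > 0" and "c + \<delta> * real m \<le> 1" and "n \<ge> 1"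
  shows "(\<exists>h :: (nat \<times> nat \<Rightarrow> nat) \<Rightarrow> real \<Rightarrow> real \<Rightarrow> nat \<Rightarrow> real.
            \<forall>X. london_data c \<delta> m n X \<longrightarrow>
              (\<forall>p\<in>{0..1}. \<forall>q\<in>{0..1}. \<forall>ts\<in>{1..m}.
                 lik c \<delta> m n X p q ts = h (marginal_counts c \<delta> m n X) p q ts))
       \<and> sufficient_statistic (\<lambda>(p, q, ts). london_sample_pmf c \<delta> m n p q ts)
            ({0..1} \<times> {0..1} \<times> {1..m}) (marginal_counts c \<delta> m n)
       \<and> (\<forall>X. london_data c \<delta> m n X \<longrightarrow>
            (\<forall>t\<in>{1..m}. MLE_set c \<delta> m n X t =
               (if t \<ge> 2 then {p_hat c \<delta> n X t} else {0..1}) \<times> {q_hat c \<delta> m n X t}))"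
proof (intro conjI)
  have "\<delta> \<noteq> 0" using \<open>\<delta> > 0\<close> by simp
  show "\<exists>h :: (nat \<times> nat \<Rightarrow> nat) \<Rightarrow> real \<Rightarrow> real \<Rightarrow> nat \<Rightarrow> real.
      \<forall>X. london_data c \<delta> m n X \<longrightarrow>
        (\<forall>p\<in>{0..1}. \<forall>q\<in>{0..1}. \<forall>ts\<in>{1..m}.
           lik c \<delta> m n X p q ts = h (marginal_counts c \<delta> m n X) p q ts)"
    using lik_eq_count_lik[OF _ \<open>\<delta> \<noteq> 0\<close>] by (intro exI[of _ "count_lik m n"]) blast
  show "sufficient_statistic (\<lambda>(p, q, ts). london_sample_pmf c \<delta> m n p q ts)
      ({0..1} \<times> {0..1} \<times> {1..m}) (marginal_counts c \<delta> m n)"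
    using \<open>\<delta> \<noteq> 0\<close> by (rule sufficient_marginal_counts)
  show "\<forall>X. london_data c \<delta> m n X \<longrightarrow>
      (\<forall>t\<in>{1..m}. MLE_set c \<delta> m n X t =
         (if t \<ge> 2 then {p_hat c \<delta> n X t} else {0..1}) \<times> {q_hat c \<delta> m n X t})"
    using MLE_set_eq[OF _ \<open>\<delta> \<noteq> 0\<close> \<open>n \<ge> 1\<close>] by blast
qed

end
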